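(* Let $f:\mathbb{R}^d\to\mathbb{R}$ be convex and $T:\mathbb{R}^d\to\mathbb{R}^d$ firmly nonexpansive with $\mathrm{Fix}\,T\neq\emptyset$, and assume that the solution set $\mathcal{S}$ of the problem of minimizing $f$ over $\mathrm{Fix}\,T$ is nonempty. Let $\tau\in\mathbb{N}_0$ and let $\{\tau_n\}_{n=0}^\infty\subset\mathbb{N}_0$ satisfy $0\le\tau_n\le\tau$ for all $n\in\mathbb{N}_0$. Let $\{\alpha_n\}_{n=0}^\infty\subset(0,\infty)$ satisfy $\lim_{n\to\infty}\alpha_n=0$ and $\sum_{n=0}^\infty\alpha_n=\infty$. Let $\{\mathbf{x}_n\}$ be generated by the Fixed-Point Delayed Subgradient Method: $\mathbf{x}_0=\mathbf{x}_{-1}=\cdots=\mathbf{x}_{-\tau}\in\mathbb{R}^d$ and $$\mathbf{x}_{n+1}=T\mathbf{x}_n-\alpha_n\widetilde{\nabla}f(T\mathbf{x}_{n-\tau_n}),\qquad n\in\mathbb{N}_0.$$ Suppose that there exists $M>0$ such that $\|\mathbf{x}_n\|\le M$ for all $n\in\mathbb{N}_0$. Then there exists a subsequence of $\{\mathbf{x}_n\}_{n=0}^\infty$ that converges to an optimal solution in $\mathcal{S}$.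
   Context: $\mathbb{R}^d$ is Euclidean space with inner product $\langle\cdot,\cdot\rangle$ and induced norm $\|\cdot\|$; $\mathbb{N}_0$ is the set of nonnegative integers. $T$ is firmly nonexpansive if $\langle T\mathbf{x}-T\mathbf{y},\mathbf{x}-\mathbf{y}\rangle\ge\|T\mathbf{x}-T\mathbf{y}\|^2$ for all $\mathbf{x},\mathbf{y}\in\mathbb{R}^d$. $\mathrm{Fix}\,T=\{\mathbf{x}\in\mathbb{R}^d:T\mathbf{x}=\mathbf{x}\}$. $\mathcal{S}$ is the set of minimizers of $f$ over $\mathrm{Fix}\,T$. For each $\mathbf{x}\in\mathbb{R}^d$, $\widetilde{\nabla}f(\mathbf{x})$ denotes a (chosen) subgradient of $f$ at $\mathbf{x}$, i.e. an element of $\partial f(\mathbf{x})=\{\mathbf{g}\in\mathbb{R}^d:\langle\mathbf{g},\mathbf{y}-\mathbf{x}\rangle\le f(\mathbf{y})-f(\mathbf{x})\ \forall\mathbf{y}\in\mathbb{R}^d\}$. *)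

theory Defs
  imports "HOL-Analysis.Analysis"
begin

definition firmly_nonexpansive :: "('a::real_inner \<Rightarrow> 'a) \<Rightarrow> bool" where
  "firmly_nonexpansive T \<longleftrightarrow>
     (\<forall>x y. inner (T x - T y) (x - y) \<ge> (norm (T x - T y))\<^sup>2)"

definition Fix :: "('a \<Rightarrow> 'a) \<Rightarrow> 'a set" where
  "Fix T = {x. T x = x}"

definition subdifferential :: "('a::real_inner \<Rightarrow> real) \<Rightarrow> 'a \<Rightarrow> 'a set" where
  "subdifferential f x = {g. \<forall>y. inner g (y - x) \<le> f y - f x}"

definition minimizers :: "('a \<Rightarrow> real) \<Rightarrow> 'a set \<Rightarrow> 'a set" where
  "minimizers f C = {x \<in> C. \<forall>y\<in>C. f x \<le> f y}"

text \<open>The sequence is indexed by the integers so that the delayed index \<open>n - \<tau>\<^sub>n\<close> may be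
  negative (subtraction on the naturals would truncate); only the entries from \<open>- \<tau>\<close> on are
  constrained. The map \<open>g\<close> is the selection of subgradients used by the method.\<close>

definition delayed_subgradient_iterates ::
  "('a::real_inner \<Rightarrow> 'a) \<Rightarrow> ('a \<Rightarrow> 'a) \<Rightarrow> (nat \<Rightarrow> real) \<Rightarrow> nat \<Rightarrow> (nat \<Rightarrow> nat) \<Rightarrow> (int \<Rightarrow> 'a) \<Rightarrow> bool"
where
  "delayed_subgradient_iterates T g \<alpha> \<tau> delay x \<longleftrightarrow>
     (\<forall>k\<in>{- int \<tau>..0}. x k = x 0) \<and>
     (\<forall>n::nat. x (int n + 1) =
        T (x (int n)) - \<alpha> n *\<^sub>R g (T (x (int n - int (delay n)))))"

end

theory Submission
  imports Defs
begin

text \<open>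
  Fix a solution \<open>z\<close>, write \<open>d n\<close> for the residual \<open>\<parallel>T (x n) - x n\<parallel>\<close> and let \<open>B\<close> bound the
  subgradients that occur; it exists because the iterates are bounded and a finite convex function
  has bounded subgradients on bounded sets. Firm nonexpansiveness makes \<open>T\<close> reduce the squared
  distance to \<open>z\<close> by at least \<open>(d n)\<^sup>2\<close>, and the subgradient step then reduces it by about
  \<open>2 * \<alpha> n * (f (T (x n)) - f z)\<close>, up to a delay error of at most
  \<open>4 * \<alpha> n * B * \<parallel>x n - x (n - delay n)\<parallel>\<close> and the second order term \<open>(\<alpha> n * B)\<^sup>2\<close>
  (lemma \<open>delayed_subgradient_step\<close>).

  The delay error is at most \<open>4 * \<alpha> n * B\<close> times the sum of the last \<open>\<tau>\<close> increments, each of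
  which is at most \<open>d k + \<alpha> k * B\<close>. By Young's inequality it is therefore a small multiple of
  \<open>\<alpha> n\<close> plus \<open>\<alpha> n\<close> times a constant times the last \<open>\<tau>\<close> squared residuals. As \<open>\<alpha>\<close> tends
  to zero, those squared residuals are absorbed by the reductions \<open>(d k)\<^sup>2\<close> won in the steps where
  they occurred (lemma \<open>sum_le_of_delayed_descent\<close>).

  Suppose that from some index on every \<open>n\<close> had \<open>d n \<ge> \<epsilon>\<close> or \<open>f (T (x n)) - f z \<ge> \<epsilon>\<close>.
  Either alternative makes the net reduction in step \<open>n\<close> at least \<open>\<epsilon> * \<alpha> n\<close>: in the first one the
  fixed amount \<open>\<epsilon>\<^sup>2\<close> dominates everything of order \<open>\<alpha> n\<close>. A nonnegative quantity cannot decrease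
  like this when the step sizes have a divergent sum. So both \<open>d n\<close> and the positive part of
  \<open>f (T (x n)) - f z\<close> are simultaneously arbitrarily small infinitely often (lemma
  \<open>delayed_subgradient_frequently_near_optimal\<close>), and compactness gives a subsequence whose limit
  \<open>w\<close> satisfies \<open>T w = w\<close> and \<open>f w \<le> f z\<close>.
\<close>

section \<open>Firmly nonexpansive maps and subgradients\<close>

lemma firmly_nonexpansive_imp_nonexpansive:
  fixes T :: "'a::real_inner \<Rightarrow> 'a"
  assumes "firmly_nonexpansive T"
  shows "norm (T u - T v) \<le> norm (u - v)"
proof -
  have "norm (T u - T v) * norm (T u - T v) \<le> inner (T u - T v) (u - v)"
    using assms by (simp add: firmly_nonexpansive_def power2_eq_square)
  also have "\<dots> \<le> norm (T u - T v) * norm (u - v)"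
    by (rule norm_cauchy_schwarz)
  finally show ?thesis
    by (cases "T u = T v") auto
qed

text \<open>Expanding \<open>u - z = (u - T u) + (T u - z)\<close>, firm nonexpansiveness at the pair \<open>u, z\<close> says
  precisely that the two summands have a nonnegative inner product.\<close>

lemma firmly_nonexpansive_Fix_ineq:
  fixes T :: "'a::real_inner \<Rightarrow> 'a"
  assumes "firmly_nonexpansive T" and "z \<in> Fix T"
  shows "(norm (T u - z))\<^sup>2 \<le> (norm (u - z))\<^sup>2 - (norm (T u - u))\<^sup>2"
proof -
  have "(norm (T u - z))\<^sup>2 \<le> inner (T u - z) (u - z)"
    using assms(1)[unfolded firmly_nonexpansive_def, rule_format, of u z] assms(2)
    by (simp add: Fix_def)
  then show ?thesis
    by (simp add: power2_norm_eq_inner algebra_simps inner_commute)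
qed

text \<open>A subgradient of norm \<open>s\<close> forces \<open>f\<close> to rise by at least \<open>s\<close> within distance one, while \<open>f\<close>,
  being continuous, is bounded on the ball of radius \<open>R + 1\<close>.\<close>

lemma subgradient_bounded_on_cball:
  fixes f :: "'a::euclidean_space \<Rightarrow> real"
  assumes cvx: "convex_on UNIV f" and sub: "\<And>y. g y \<in> subdifferential f y"
  obtains B where "B \<ge> 0" "\<And>u. u \<in> cball z R \<Longrightarrow> norm (g u) \<le> B"
proof -
  have cont: "continuous_on UNIV f"
    using convex_on_continuous[OF open_UNIV cvx] .
  have "compact (f ` cball z (R + 1))"
    by (intro compact_continuous_image continuous_on_subset[OF cont]) auto
  then obtain C where C: "\<And>u. u \<in> cball z (R + 1) \<Longrightarrow> \<bar>f u\<bar> \<le> C"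
    by (metis compact_imp_bounded bounded_iff imageI real_norm_def)
  have "norm (g u) \<le> 2 * \<bar>C\<bar>" if u: "u \<in> cball z R" for u
  proof (cases "g u = 0")
    case False
    \<comment> \<open>Testing the subgradient inequality one unit away, in the direction of the subgradient.\<close>
    define v where "v = u + g u /\<^sub>R norm (g u)"
    have "norm (v - u) = 1" using False by (simp add: v_def)
    then have "v \<in> cball z (R + 1)"
      using u norm_triangle_ineq[of "u - z" "v - u"]
      by (simp add: dist_norm norm_minus_commute[of z])
    moreover have "u \<in> cball z (R + 1)" using u by simp
    moreover have "inner (g u) (v - u) = norm (g u)"
      by (simp add: v_def dot_square_norm power2_eq_square False)
    then have "norm (g u) \<le> f v - f u"
      using sub[of u] by (metis (no_types, lifting) mem_Collect_eq subdifferential_def)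
    ultimately show ?thesis using C[of u] C[of v] by linarith
  qed simp
  then show ?thesis using that[of "2 * \<bar>C\<bar>"] by simp
qed

section \<open>Two facts on real and bounded sequences\<close>

text \<open>In step \<open>n\<close> the quantity \<open>a\<close> falls by \<open>b n + s n\<close>, but \<open>c\<close> times the last \<open>\<tau>\<close> values of \<open>b\<close> is
  charged against this. Each \<open>b n\<close> is charged in the \<open>\<tau>\<close> steps that follow, so it pays for all its
  charges when \<open>c * \<tau> \<le> 1\<close>, and the decrease by \<open>s\<close> remains. The bookkeeping is done by a Lyapunov
  function \<open>V\<close>, in which \<open>b (n - Suc i)\<close> is weighted by the number \<open>\<tau> - i\<close> of charges still to
  come.\<close>

lemma sum_le_of_delayed_descent:
  fixes a b s :: "nat \<Rightarrow> real"
  assumes a: "\<And>n. a n \<ge> 0" and b: "\<And>n. b n \<ge> 0"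
    and c: "c \<ge> 0" "c * real \<tau> \<le> 1"
    and descent: "\<And>n. n \<ge> N \<Longrightarrow> a (Suc n) \<le> a n - b n - s n + c * (\<Sum>i<\<tau>. b (n - Suc i))"
  shows "(\<Sum>k<K. s (N + k)) \<le> a N + c * (\<Sum>i<\<tau>. real (\<tau> - i) * b (N - Suc i))"
proof -
  define W where "W n = (\<Sum>i<\<tau>. real (\<tau> - i) * b (n - Suc i))" for n
  define V where "V n = a n + c * W n" for n
  have W_step: "W (Suc n) + (\<Sum>i<\<tau>. b (n - Suc i)) = real \<tau> * b n + W n" for n
  proof -
    have "W (Suc n) = (\<Sum>i<Suc \<tau>. real (\<tau> - i) * b (n - i))"
      by (simp add: W_def)
    \<comment> \<open>The extra term \<open>i = \<tau>\<close> has weight zero; it makes room for splitting off \<open>i = 0\<close>.\<close>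
    also have "\<dots> = real \<tau> * b n + (\<Sum>i<\<tau>. real (\<tau> - Suc i) * b (n - Suc i))"
      by (subst sum.lessThan_Suc_shift) simp
    also have "(\<Sum>i<\<tau>. real (\<tau> - Suc i) * b (n - Suc i)) + (\<Sum>i<\<tau>. b (n - Suc i)) = W n"
      unfolding W_def sum.distrib[symmetric]
      by (rule sum.cong) (auto simp: of_nat_diff algebra_simps)
    then have "real \<tau> * b n + (\<Sum>i<\<tau>. real (\<tau> - Suc i) * b (n - Suc i))
        = real \<tau> * b n + W n - (\<Sum>i<\<tau>. b (n - Suc i))" by simp
    finally show ?thesis by simp
  qed
  have V_step: "s n \<le> V n - V (Suc n)" if "n \<ge> N" for n
  proof -
    have "c * W (Suc n) + c * (\<Sum>i<\<tau>. b (n - Suc i)) = c * real \<tau> * b n + c * W n"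
      using W_step[of n] by (metis distrib_left mult.assoc)
    moreover have "c * real \<tau> * b n \<le> 1 * b n"
      by (rule mult_right_mono[OF c(2) b])
    ultimately show ?thesis using descent[OF that] by (simp add: V_def)
  qed
  have "(\<Sum>k<K. s (N + k)) \<le> (\<Sum>k<K. V (N + k) - V (N + Suc k))"
    by (intro sum_mono) (use V_step in simp)
  also have "\<dots> = V N - V (N + K)"
    by (subst sum_lessThan_telescope') simp
  also have "V (N + K) \<ge> 0"
    unfolding V_def W_def by (intro add_nonneg_nonneg mult_nonneg_nonneg sum_nonneg a b c) auto
  then have "V N - V (N + K) \<le> V N" by simp
  finally show ?thesis by (simp add: V_def W_def)
qed

lemma subsequence_limit_of_frequently_small:
  fixes y :: "nat \<Rightarrow> 'a::heine_borel" and \<phi> :: "'a \<Rightarrow> real"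
  assumes bdd: "bounded (range y)" and cont: "continuous_on UNIV \<phi>"
    and small: "\<And>\<epsilon> N. \<epsilon> > 0 \<Longrightarrow> \<exists>n\<ge>N. \<phi> (y n) < \<epsilon>"
  shows "\<exists>r z. strict_mono (r :: nat \<Rightarrow> nat) \<and> \<phi> z \<le> 0 \<and> (\<lambda>k. y (r k)) \<longlonglongrightarrow> z"
proof -
  have "\<exists>r. \<forall>k. \<phi> (y (r k)) < 1 / real (Suc k) \<and> r k < r (Suc k)"
  proof (rule dependent_nat_choice[where P = "\<lambda>k n. \<phi> (y n) < 1 / real (Suc k)" and Q = "\<lambda>_. (<)"])
    show "\<exists>n. \<phi> (y n) < 1 / real (Suc 0)" using small[of 1 0] by auto
    show "\<exists>m. \<phi> (y m) < 1 / real (Suc (Suc k)) \<and> n < m" for n k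
      using small[of "1 / real (Suc (Suc k))" "Suc n"] by (auto simp: Suc_le_eq)
  qed
  then obtain r where r: "\<And>k. \<phi> (y (r k)) < 1 / real (Suc k)" "strict_mono (r :: nat \<Rightarrow> nat)"
    by (auto simp: strict_mono_Suc_iff)
  have "bounded (range (y \<circ> r))"
    by (rule bounded_subset[OF bdd]) auto
  then obtain z q where q: "strict_mono (q :: nat \<Rightarrow> nat)" "((y \<circ> r) \<circ> q) \<longlonglongrightarrow> z"
    using bounded_imp_convergent_subsequence by blast
  have lim: "(\<lambda>k. y ((r \<circ> q) k)) \<longlonglongrightarrow> z" using q(2) by (simp add: o_def)
  have "(\<lambda>k. \<phi> (y ((r \<circ> q) k))) \<longlonglongrightarrow> \<phi> z"
    by (rule continuous_on_tendsto_compose[OF cont lim]) auto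
  moreover have "(\<lambda>k. 1 / real (Suc (q k))) \<longlonglongrightarrow> 0"
    using LIMSEQ_subseq_LIMSEQ[OF LIMSEQ_inverse_real_of_nat q(1)]
    by (simp add: o_def inverse_eq_divide)
  ultimately have "\<phi> z \<le> 0"
    by (rule LIMSEQ_le) (use r(1) in \<open>auto intro: less_imp_le\<close>)
  then show ?thesis using lim strict_mono_o[OF r(2) q(1)] by blast
qed

section \<open>The descent inequality\<close>

text \<open>The subgradient is taken at \<open>T w\<close>, but the gain is expressed by the value of \<open>f\<close> at \<open>T u\<close>. Two
  subgradient inequalities carry this out, at \<open>T w\<close> towards \<open>z\<close> and at \<open>T u\<close> towards \<open>T w\<close>; moving
  between \<open>T u\<close> and \<open>T w\<close> costs \<open>B * norm (u - w)\<close> in each, whence the factor \<open>2\<close>. Evaluating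
  \<open>f\<close> at \<open>T u\<close> ties the gain to the same index as the residual \<open>norm (T u - u)\<close>.\<close>

lemma delayed_subgradient_step:
  fixes T :: "'a::real_inner \<Rightarrow> 'a"
  assumes T: "firmly_nonexpansive T" and z: "z \<in> Fix T"
    and sub: "\<And>y. g y \<in> subdifferential f y"
    and B: "norm (g (T u)) \<le> B" "norm (g (T w)) \<le> B" and \<alpha>: "\<alpha> \<ge> 0"
  shows "(norm (T u - \<alpha> *\<^sub>R g (T w) - z))\<^sup>2
    \<le> (norm (u - z))\<^sup>2 - (norm (T u - u))\<^sup>2
      - 2 * \<alpha> * (f (T u) - f z - 2 * B * norm (u - w)) + \<alpha>\<^sup>2 * B\<^sup>2"
proof -
  let ?G = "g (T w)"
  have B0: "B \<ge> 0" using B(1) norm_ge_zero order_trans by blast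
  have cs: "inner h (T u - T w) \<le> B * norm (u - w)"
    "- inner h (T u - T w) \<le> B * norm (u - w)" if "norm h \<le> B" for h
  proof -
    have "\<bar>inner h (T u - T w)\<bar> \<le> norm h * norm (T u - T w)"
      by (rule Cauchy_Schwarz_ineq2)
    also have "\<dots> \<le> B * norm (u - w)"
      by (intro mult_mono that firmly_nonexpansive_imp_nonexpansive[OF T] B0 norm_ge_zero)
    finally show "inner h (T u - T w) \<le> B * norm (u - w)"
      "- inner h (T u - T w) \<le> B * norm (u - w)" by auto
  qed
  have "inner ?G (z - T w) \<le> f z - f (T w)"
    using sub[of "T w"] by (simp add: subdifferential_def)
  moreover have "inner (g (T u)) (T w - T u) \<le> f (T w) - f (T u)"
    using sub[of "T u"] by (simp add: subdifferential_def)
  ultimately have "f (T u) - f z - 2 * B * norm (u - w) \<le> inner ?G (T u - z)"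
    using cs(1)[OF B(1)] cs(2)[OF B(2)] by (simp add: inner_diff_right)
  then have 1: "2 * \<alpha> * (f (T u) - f z - 2 * B * norm (u - w)) \<le> 2 * \<alpha> * inner ?G (T u - z)"
    using \<alpha> by (intro mult_left_mono) auto
  have "(norm ?G)\<^sup>2 \<le> B\<^sup>2" using B(2) by (intro power_mono) auto
  then have 2: "\<alpha>\<^sup>2 * (norm ?G)\<^sup>2 \<le> \<alpha>\<^sup>2 * B\<^sup>2" by (intro mult_left_mono) auto
  have "(norm (T u - \<alpha> *\<^sub>R ?G - z))\<^sup>2 = (norm ((T u - z) - \<alpha> *\<^sub>R ?G))\<^sup>2"
    by (simp add: algebra_simps)
  also have "\<dots> = (norm (T u - z))\<^sup>2 - 2 * \<alpha> * inner ?G (T u - z) + \<alpha>\<^sup>2 * (norm ?G)\<^sup>2"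
    unfolding power2_norm_eq_inner
    by (simp add: inner_diff_left inner_diff_right inner_commute power2_eq_square algebra_simps)
  finally show ?thesis
    using 1 2 firmly_nonexpansive_Fix_ineq[OF T z, of u] by linarith
qed

lemma young_ineq:
  fixes p \<delta> :: real
  assumes "\<delta> > 0"
  shows "4 * p \<le> \<delta> + 4 * p\<^sup>2 / \<delta>"
proof -
  have "0 \<le> (\<delta> - 2 * p)\<^sup>2" by simp
  also have "\<dots> = \<delta> * \<delta> + 4 * p\<^sup>2 - 4 * p * \<delta>"
    by (simp add: power2_eq_square algebra_simps)
  finally have "4 * p * \<delta> \<le> \<delta> * \<delta> + 4 * p\<^sup>2" by simp
  then have "4 * p \<le> (\<delta> * \<delta> + 4 * p\<^sup>2) / \<delta>"
    using assms by (simp only: pos_le_divide_eq)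
  then show ?thesis using assms by (simp add: add_divide_distrib)
qed

lemma norm_diff_delayed_le:
  fixes y :: "nat \<Rightarrow> 'a::real_normed_vector"
  assumes "m \<le> \<tau>" "\<tau> \<le> n"
  shows "norm (y n - y (n - m)) \<le> (\<Sum>i<\<tau>. norm (y (Suc (n - Suc i)) - y (n - Suc i)))"
proof -
  have "y n - y (n - m) = (\<Sum>i<m. y (n - i) - y (n - Suc i))"
    by (subst sum_lessThan_telescope') simp
  also have "\<dots> = (\<Sum>i<m. y (Suc (n - Suc i)) - y (n - Suc i))"
    using assms by (intro sum.cong) (auto simp: Suc_diff_Suc)
  also have "norm \<dots> \<le> (\<Sum>i<m. norm (y (Suc (n - Suc i)) - y (n - Suc i)))"
    by (rule norm_sum)
  also have "\<dots> \<le> (\<Sum>i<\<tau>. norm (y (Suc (n - Suc i)) - y (n - Suc i)))"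
    using assms(1) by (intro sum_mono2) auto
  finally show ?thesis .
qed

text \<open>If the conclusion failed, every late step would reduce the squared distance to \<open>z\<close> by
  \<open>\<epsilon> * \<alpha> n\<close> and half the squared residual, at the price of a small multiple of the last \<open>\<tau>\<close>
  squared residuals. By \<open>sum_le_of_delayed_descent\<close> this bounds the partial sums of \<open>\<alpha>\<close>. The recursion
  is only required from index \<open>\<tau>\<close> on, where \<open>n - delay n\<close> is a true difference.\<close>

lemma delayed_subgradient_frequently_near_optimal:
  fixes f :: "'a::euclidean_space \<Rightarrow> real" and y :: "nat \<Rightarrow> 'a"
  assumes cvx: "convex_on UNIV f" and T: "firmly_nonexpansive T" and z: "z \<in> Fix T"
    and sub: "\<And>u. g u \<in> subdifferential f u"
    and delay: "\<And>n. delay n \<le> \<tau>"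
    and \<alpha>_pos: "\<And>n. 0 < \<alpha> n" and \<alpha>_lim: "\<alpha> \<longlonglongrightarrow> 0"
    and \<alpha>_sum: "filterlim (\<lambda>N. \<Sum>n<N. \<alpha> n) at_top sequentially"
    and step: "\<And>n. n \<ge> \<tau> \<Longrightarrow> y (Suc n) = T (y n) - \<alpha> n *\<^sub>R g (T (y (n - delay n)))"
    and bdd: "bounded (range y)" and \<epsilon>: "\<epsilon> > 0"
  shows "\<exists>n\<ge>N. max (norm (T (y n) - y n)) (f (T (y n)) - f z) < \<epsilon>"
proof (rule ccontr)
  assume "\<not> ?thesis"
  then have far: "norm (T (y n) - y n) \<ge> \<epsilon> \<or> f (T (y n)) - f z \<ge> \<epsilon>" if "n \<ge> N" for n
    using that by (metis max_less_iff_conj not_less)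
  obtain R where R: "\<And>n. norm (y n - z) \<le> R"
    using bdd bounded_any_center[of "range y" z] by (auto simp: dist_norm norm_minus_commute)
  have R0: "R \<ge> 0" using R[of 0] norm_ge_zero order_trans by blast
  obtain B where B0: "B \<ge> 0" and B: "\<And>u. u \<in> cball z R \<Longrightarrow> norm (g u) \<le> B"
    using subgradient_bounded_on_cball[OF cvx sub] by metis
  have Tz: "T z = z" using z by (simp add: Fix_def)
  have TyR: "norm (T (y n) - z) \<le> R" for n
    using firmly_nonexpansive_imp_nonexpansive[OF T, of "y n" z] R[of n] Tz by simp
  have gB: "norm (g (T (y n))) \<le> B" for n
    using TyR[of n] by (intro B) (simp add: dist_norm norm_minus_commute)
  have f_lower: "- (B * R) \<le> f (T (y n)) - f z" for n
  proof -
    have "\<bar>inner (g z) (T (y n) - z)\<bar> \<le> norm (g z) * norm (T (y n) - z)"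
      by (rule Cauchy_Schwarz_ineq2)
    also have "\<dots> \<le> B * R"
      using B[of z] R0 B0 TyR by (intro mult_mono) auto
    finally show ?thesis
      using sub[of z] by (auto simp: subdifferential_def dest!: spec[of _ "T (y n)"])
  qed
  define d where "d n = norm (T (y n) - y n)" for n
  define e where "e n = f (T (y n)) - f z" for n
  define a where "a n = (norm (y n - z))\<^sup>2" for n
  \<comment> \<open>The parameter of Young's inequality: \<open>\<tau>\<close> delayed increments may cost at most half of \<open>\<epsilon>\<close>.\<close>
  define \<delta> where "\<delta> = \<epsilon> / (2 * (real \<tau> + 1))"
  have \<delta>: "\<delta> > 0" "real \<tau> * \<delta> \<le> \<epsilon> / 2"
    using \<epsilon> by (auto simp: \<delta>_def field_simps)
  define L where "L = 4 * B\<^sup>2 / \<delta>"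
  have L0: "L \<ge> 0" using \<delta> by (simp add: L_def)
  have ex_small: "\<exists>\<gamma>>0. \<gamma> * p \<le> \<epsilon> / 2 \<and> \<gamma> * q \<le> \<epsilon>\<^sup>2 \<and> \<gamma> * r \<le> 1"
    if "p \<ge> 0" "q \<ge> 0" "r \<ge> 0" for p q r :: real
  proof -
    define \<gamma> where "\<gamma> = min (\<epsilon> / 2 / (p + 1)) (min (\<epsilon>\<^sup>2 / (q + 1)) (1 / (r + 1)))"
    have le: "\<gamma> * t \<le> s" if "\<gamma> > 0" "\<gamma> \<le> s / (t + 1)" "t \<ge> 0" for s t
    proof -
      have "\<gamma> * (t + 1) \<le> s" using that by (simp add: field_simps)
      then show ?thesis using that by (simp add: algebra_simps)
    qed
    have "\<gamma> > 0" using that \<epsilon> by (simp add: \<gamma>_def)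
    moreover have "\<gamma> \<le> \<epsilon> / 2 / (p + 1)" "\<gamma> \<le> \<epsilon>\<^sup>2 / (q + 1)" "\<gamma> \<le> 1 / (r + 1)"
      by (auto simp: \<gamma>_def)
    ultimately show ?thesis using le that by meson
  qed
  \<comment> \<open>The step size must be so small that, in this order, the terms of second order in the step
    sizes use up the other half of \<open>\<epsilon>\<close>; a squared residual of at least \<open>\<epsilon>\<^sup>2\<close> outweighs a
    negative \<open>f (T (y n)) - f z\<close>; and each squared residual pays for its \<open>\<tau>\<close> later charges.\<close>
  obtain \<gamma> where \<gamma>: "\<gamma> > 0" "\<gamma> * ((4 * real \<tau> + 1) * B\<^sup>2) \<le> \<epsilon> / 2"
    "\<gamma> * (4 * (B * R) + 4 * \<epsilon>) \<le> \<epsilon>\<^sup>2" "\<gamma> * (2 * L * real \<tau>) \<le> 1"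
    using ex_small[of "(4 * real \<tau> + 1) * B\<^sup>2" "4 * (B * R) + 4 * \<epsilon>" "2 * L * real \<tau>"]
      B0 R0 \<epsilon> L0 by auto
  have "eventually (\<lambda>n. \<alpha> n < \<gamma>) sequentially"
    using order_tendstoD(2)[OF \<alpha>_lim \<gamma>(1)] .
  then obtain N1 where N1: "\<And>n. n \<ge> N1 \<Longrightarrow> \<alpha> n \<le> \<gamma>"
    by (auto simp: eventually_sequentially intro: less_imp_le)
  \<comment> \<open>The indices from \<open>M - \<tau>\<close> on already have small steps and obey the recursion.\<close>
  define M where "M = max N N1 + 2 * \<tau>"
  have descent: "a (Suc n) \<le> a n - (d n)\<^sup>2 / 2 - \<epsilon> * \<alpha> n
      + (2 * L * \<gamma>) * (\<Sum>i<\<tau>. (d (n - Suc i))\<^sup>2 / 2)" if n: "n \<ge> M" for n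
  proof -
    define S where "S = (\<Sum>i<\<tau>. (d (n - Suc i))\<^sup>2)"
    define D where "D = norm (y n - y (n - delay n))"
    have S0: "S \<ge> 0" by (simp add: S_def sum_nonneg)
    have \<alpha>n: "0 < \<alpha> n" "\<alpha> n \<le> \<gamma>" using \<alpha>_pos N1 n by (auto simp: M_def)
    have incr: "4 * B * norm (y (Suc k) - y k) \<le> \<delta> + L * (d k)\<^sup>2 + 4 * B\<^sup>2 * \<gamma>"
      if k: "k \<ge> \<tau>" "k \<ge> N1" for k
    proof -
      let ?G = "g (T (y (k - delay k)))"
      have eq: "y (Suc k) - y k = (T (y k) - y k) - \<alpha> k *\<^sub>R ?G"
        using step[OF k(1)] by simp
      have "norm (y (Suc k) - y k) \<le> d k + \<alpha> k * norm ?G"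
        unfolding eq using norm_triangle_ineq4[of "T (y k) - y k" "\<alpha> k *\<^sub>R ?G"] \<alpha>_pos[of k]
        by (simp add: d_def)
      also have "\<alpha> k * norm ?G \<le> \<gamma> * B"
        using N1[OF k(2)] gB \<gamma>(1) by (intro mult_mono) auto
      finally have "4 * B * norm (y (Suc k) - y k) \<le> 4 * B * (d k + \<gamma> * B)"
        using B0 by (intro mult_left_mono) auto
      moreover have "4 * (B * d k) \<le> \<delta> + 4 * (B * d k)\<^sup>2 / \<delta>"
        by (rule young_ineq[OF \<delta>(1)])
      ultimately show ?thesis
        by (simp add: L_def power_mult_distrib power2_eq_square algebra_simps)
    qed
    have "4 * B * D \<le> 4 * B * (\<Sum>i<\<tau>. norm (y (Suc (n - Suc i)) - y (n - Suc i)))"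
      unfolding D_def using n B0 delay[of n]
      by (intro mult_left_mono norm_diff_delayed_le) (auto simp: M_def)
    also have "\<dots> \<le> (\<Sum>i<\<tau>. \<delta> + L * (d (n - Suc i))\<^sup>2 + 4 * B\<^sup>2 * \<gamma>)"
      unfolding sum_distrib_left using n by (intro sum_mono incr) (auto simp: M_def)
    also have "\<dots> = real \<tau> * \<delta> + L * S + \<gamma> * (4 * real \<tau> * B\<^sup>2)"
      by (simp add: S_def sum.distrib sum_distrib_left)
    also have "\<dots> \<le> \<epsilon> / 2 + L * S + \<gamma> * (4 * real \<tau> * B\<^sup>2)" using \<delta>(2) by simp
    finally have D_bound: "4 * B * D \<le> \<epsilon> / 2 + L * S + \<gamma> * (4 * real \<tau> * B\<^sup>2)" .
    have "\<alpha> n * B\<^sup>2 \<le> \<gamma> * B\<^sup>2" using \<alpha>n by (intro mult_right_mono) auto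
    with D_bound have "4 * B * D + \<alpha> n * B\<^sup>2 \<le> \<epsilon> + L * S"
      using \<gamma>(2) by (simp add: algebra_simps)
    then have "\<alpha> n * (4 * B * D + \<alpha> n * B\<^sup>2) \<le> \<alpha> n * (\<epsilon> + L * S)"
      using \<alpha>n by (intro mult_left_mono) auto
    moreover have "a (Suc n) \<le> a n - (d n)\<^sup>2 - 2 * \<alpha> n * (e n - 2 * B * D) + (\<alpha> n)\<^sup>2 * B\<^sup>2"
      using delayed_subgradient_step[OF T z sub gB[of n] gB[of "n - delay n"], of "\<alpha> n"]
        step[of n] n \<alpha>n by (simp add: a_def d_def e_def D_def M_def)
    moreover have "\<alpha> n * (L * S) \<le> \<gamma> * (L * S)"
      using \<alpha>n L0 S0 by (intro mult_right_mono) auto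
    ultimately have main: "a (Suc n) \<le> a n - (d n)\<^sup>2 - 2 * \<alpha> n * e n + \<epsilon> * \<alpha> n + \<gamma> * (L * S)"
      by (simp add: algebra_simps power2_eq_square)
    have "\<epsilon> * \<alpha> n * 2 \<le> (d n)\<^sup>2 / 2 + 2 * \<alpha> n * e n"
    proof (cases "e n \<ge> \<epsilon>")
      case True
      then have "2 * \<alpha> n * \<epsilon> \<le> 2 * \<alpha> n * e n"
        using \<alpha>n by (intro mult_left_mono) auto
      then have "\<epsilon> * \<alpha> n * 2 \<le> 2 * \<alpha> n * e n" by (simp only: mult_ac)
      then show ?thesis using zero_le_power2[of "d n"] by linarith
    next
      case False
      then have "d n \<ge> \<epsilon>" using far[of n] n by (auto simp: d_def e_def M_def)
      then have "\<epsilon>\<^sup>2 \<le> (d n)\<^sup>2" using \<epsilon> by (intro power_mono) auto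
      moreover have "\<alpha> n * (4 * (B * R) + 4 * \<epsilon>) \<le> \<gamma> * (4 * (B * R) + 4 * \<epsilon>)"
        using \<alpha>n B0 R0 \<epsilon> by (intro mult_right_mono) auto
      moreover have "\<alpha> n * - (B * R) \<le> \<alpha> n * e n"
        using \<alpha>n f_lower by (intro mult_left_mono) (auto simp: e_def)
      ultimately show ?thesis using \<gamma>(3) by (simp add: algebra_simps)
    qed
    moreover have "(2 * L * \<gamma>) * (\<Sum>i<\<tau>. (d (n - Suc i))\<^sup>2 / 2) = \<gamma> * (L * S)"
      by (simp add: S_def sum_divide_distrib[symmetric])
    ultimately show ?thesis using main by linarith
  qed
  define C where "C = a M + (2 * L * \<gamma>) * (\<Sum>i<\<tau>. real (\<tau> - i) * ((d (M - Suc i))\<^sup>2 / 2))"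
  have bound: "(\<Sum>k<K. \<epsilon> * \<alpha> (M + k)) \<le> C" for K
    unfolding C_def
    by (rule sum_le_of_delayed_descent[OF _ _ _ _ descent])
      (use L0 \<gamma> in \<open>auto simp: a_def M_def algebra_simps\<close>)
  obtain K where K: "(\<Sum>n<K. \<alpha> n) > (\<Sum>n<M. \<alpha> n) + C / \<epsilon>"
    using \<alpha>_sum by (metis (mono_tags, lifting) eventually_sequentially filterlim_at_top_dense order_refl)
  have "(\<Sum>n<K. \<alpha> n) \<le> (\<Sum>n<M + K. \<alpha> n)"
    using \<alpha>_pos by (intro sum_mono2) (auto intro: less_imp_le)
  also have "\<dots> = (\<Sum>n<M. \<alpha> n) + (\<Sum>k<K. \<alpha> (M + k))"
    by (induction K) auto
  finally have "\<epsilon> * (C / \<epsilon>) < \<epsilon> * (\<Sum>k<K. \<alpha> (M + k))"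
    using K \<epsilon> by (intro mult_strict_left_mono) auto
  then show False using bound[of K] \<epsilon> by (simp add: sum_distrib_left)
qed

section \<open>Convergence of a subsequence\<close>

theorem theorem3p10:
  fixes f :: "real ^ 'd \<Rightarrow> real"
    and T :: "real ^ 'd \<Rightarrow> real ^ 'd"
    and g :: "real ^ 'd \<Rightarrow> real ^ 'd"
    and \<tau> :: nat
    and delay :: "nat \<Rightarrow> nat"
    and \<alpha> :: "nat \<Rightarrow> real"
    and x :: "int \<Rightarrow> real ^ 'd"
  assumes "convex_on UNIV f"
    and "firmly_nonexpansive T"
    and "Fix T \<noteq> {}"
    and "minimizers f (Fix T) \<noteq> {}"
    and "\<And>y. g y \<in> subdifferential f y"
    and "\<And>n. delay n \<le> \<tau>"
    and "\<And>n. 0 < \<alpha> n"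
    and "\<alpha> \<longlonglongrightarrow> 0"
    and "filterlim (\<lambda>N. \<Sum>n<N. \<alpha> n) at_top sequentially"
    and "delayed_subgradient_iterates T g \<alpha> \<tau> delay x"
    and "\<exists>M>0. \<forall>n::nat. norm (x (int n)) \<le> M"
  shows "\<exists>r z. strict_mono (r :: nat \<Rightarrow> nat) \<and> z \<in> minimizers f (Fix T) \<and>
           (\<lambda>k. x (int (r k))) \<longlonglongrightarrow> z"
proof -
  \<comment> \<open>From step \<open>\<tau>\<close> on, the recursion only reads entries with nonnegative index.\<close>
  define y where "y n = x (int n)" for n
  obtain z where z: "z \<in> Fix T" "\<And>u. u \<in> Fix T \<Longrightarrow> f z \<le> f u"
    using assms(4) by (auto simp: minimizers_def)
  have bdd: "bounded (range y)"
    using assms(11) by (auto simp: bounded_iff y_def)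
  have step: "y (Suc n) = T (y n) - \<alpha> n *\<^sub>R g (T (y (n - delay n)))" if "n \<ge> \<tau>" for n
    using assms(10) assms(6)[of n] that
    by (simp add: delayed_subgradient_iterates_def y_def of_nat_diff add.commute)
  have contT: "continuous_on UNIV T"
    by (rule lipschitz_on_continuous_on[of 1])
      (auto intro!: lipschitz_onI
        simp: dist_norm firmly_nonexpansive_imp_nonexpansive[OF assms(2)])
  have contf: "continuous_on UNIV f"
    using convex_on_continuous[OF open_UNIV assms(1)] .
  have "continuous_on UNIV (\<lambda>u. max (norm (T u - u)) (f (T u) - f z))"
    by (intro continuous_intros contT continuous_on_compose2[OF contf contT]) auto
  from subsequence_limit_of_frequently_small[OF bdd this
      delayed_subgradient_frequently_near_optimal[OF assms(1,2) z(1) assms(5-9) step bdd]]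
  obtain r w where r: "strict_mono r" "(\<lambda>k. y (r k)) \<longlonglongrightarrow> w"
    and w: "norm (T w - w) \<le> 0" "f (T w) \<le> f z"
    by auto
  have "T w = w" using w(1) by simp
  then have "w \<in> minimizers f (Fix T)"
    using w(2) z(2) by (force simp: minimizers_def Fix_def)
  then show ?thesis using r unfolding y_def by blast
qed

end
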